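(* Let $P\in\mathbb{R}_+^{m\times n}$ be a probability matrix and let $k\le\min\{m,n\}$ be a positive integer. Then the function $(\mathbf{P},\mathbf{Q})\mapsto D(\mathbf{P}||\mathbf{Q})$ attains a minimum on $\boldsymbol{\mathcal{P}}\times\boldsymbol{\mathcal{Q}}$, and $$\min_{Q\in\mathcal{Q}}D(P||Q)=\min_{\mathbf{P}\in\boldsymbol{\mathcal{P}},\,\mathbf{Q}\in\boldsymbol{\mathcal{Q}}}D(\mathbf{P}||\mathbf{Q}).$$
   Context: $\mathbb{R}_+=[0,\infty)$. A probability matrix is a matrix $P$ with $P(ij)\ge 0$ and $\sum_{ij}P(ij)=1$. $e$ denotes a column vector of ones of the appropriate size. Given $P$ and $k$, define $$\boldsymbol{\mathcal{P}}=\Big\{\mathbf{P}\in\mathbb{R}_+^{m\times k\times n}:\ \sum_{l}\mathbf{P}(ilj)=P(ij)\ \text{for all } i,j\Big\},$$ $$\boldsymbol{\mathcal{Q}}=\Big\{\mathbf{Q}\in\mathbb{R}_+^{m\times k\times n}:\ \mathbf{Q}(ilj)=Q_-(il)Q_+(lj)\ \text{for some } Q_-\in\mathbb{R}_+^{m\times k},\ Q_+\in\mathbb{R}_+^{k\times n}\ \text{with } Q_+e=e,\ e^\top Q_-e=1\Big\},$$ $$\mathcal{Q}=\Big\{Q\in\mathbb{R}_+^{m\times n}:\ Q(ij)=\sum_l\mathbf{Q}(ilj)\ \text{for some }\mathbf{Q}\in\boldsymbol{\mathcal{Q}}\Big\}.$$ For nonnegative numbers $p,q$ the I-divergence is $D(p||q)=p\log\frac{p}{q}-p+q\in[0,\infty]$,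 with the conventions $0/0=0$, $0\log0=0$, $p/0=\infty$ for $p>0$; for nonnegative matrices or tensors of the same size, $D$ is the sum of the I-divergences of the corresponding entries. *)

theory Defs
  imports "HOL-Analysis.Analysis"
begin

text \<open>
  An \<open>m \<times> n\<close> matrix is an element of \<open>real ^ 'n ^ 'm\<close>, and an \<open>m \<times> k \<times> n\<close> tensor \<open>T\<close> is an element
  of \<open>real ^ 'n ^ 'k ^ 'm\<close>, with \<open>T(ilj) = T $ i $ l $ j\<close>; here \<open>m\<close>, \<open>k\<close>, \<open>n\<close> are \<open>CARD('m)\<close>,
  \<open>CARD('k)\<close>, \<open>CARD('n)\<close>. The column vector \<open>e\<close> of ones is the vector \<open>1\<close>.
\<close>

definition prob_matrix :: "real ^ 'n ^ 'm \<Rightarrow> bool" where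
  "prob_matrix P \<longleftrightarrow> (\<forall>i j. 0 \<le> P $ i $ j) \<and> (\<Sum>i\<in>UNIV. \<Sum>j\<in>UNIV. P $ i $ j) = 1"

text \<open>
  The divergence of two numbers, meant for \<open>p, q \<ge> 0\<close>. If \<open>p = 0\<close>, the second branch gives \<open>q\<close>,
  in accordance with the convention \<open>0 log 0 = 0\<close> (and \<open>0 / 0 = 0\<close> if also \<open>q = 0\<close>).
\<close>

definition I_div :: "real \<Rightarrow> real \<Rightarrow> ereal" where
  "I_div p q = (if p > 0 \<and> q = 0 then \<infinity> else ereal (p * ln (p / q) - p + q))"

definition I_div_matrix :: "real ^ 'n ^ 'm \<Rightarrow> real ^ 'n ^ 'm \<Rightarrow> ereal" where
  "I_div_matrix P Q = (\<Sum>i\<in>UNIV. \<Sum>j\<in>UNIV. I_div (P $ i $ j) (Q $ i $ j))"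

definition I_div_tensor :: "real ^ 'n ^ 'k ^ 'm \<Rightarrow> real ^ 'n ^ 'k ^ 'm \<Rightarrow> ereal" where
  "I_div_tensor S T =
     (\<Sum>i\<in>UNIV. \<Sum>l\<in>UNIV. \<Sum>j\<in>UNIV. I_div (S $ i $ l $ j) (T $ i $ l $ j))"

definition tensor_P :: "real ^ 'n ^ 'm \<Rightarrow> (real ^ 'n ^ 'k ^ 'm) set" where
  "tensor_P P = {S. (\<forall>i l j. 0 \<le> S $ i $ l $ j) \<and>
                    (\<forall>i j. (\<Sum>l\<in>UNIV. S $ i $ l $ j) = P $ i $ j)}"

definition tensor_Q :: "(real ^ 'n ^ 'k ^ 'm) set" where
  "tensor_Q = {T. (\<forall>i l j. 0 \<le> T $ i $ l $ j) \<and>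
                  (\<exists>(Qm :: real ^ 'k ^ 'm) (Qp :: real ^ 'n ^ 'k).
                     (\<forall>i l. 0 \<le> Qm $ i $ l) \<and> (\<forall>l j. 0 \<le> Qp $ l $ j) \<and>
                     Qp *v 1 = 1 \<and> 1 \<bullet> (Qm *v 1) = 1 \<and>
                     (\<forall>i l j. T $ i $ l $ j = Qm $ i $ l * Qp $ l $ j))}"

text \<open>The inner size \<open>k\<close> does not occur in the type of the matrices, hence the type argument.\<close>

definition matrix_Q :: "'k::finite itself \<Rightarrow> (real ^ 'n ^ 'm) set" where
  "matrix_Q _ = {Q. (\<forall>i j. 0 \<le> Q $ i $ j) \<and>
                    (\<exists>T \<in> (tensor_Q :: (real ^ 'n ^ 'k ^ 'm) set).
                       \<forall>i j. Q $ i $ j = (\<Sum>l\<in>UNIV. T $ i $ l $ j))}"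

end

theory Submission
  imports Defs "HOL-Real_Asymp.Real_Asymp"
begin

text \<open>
  The factor pairs form a compact set, hence so do the tensors and the matrices they generate.
  For \<open>p \<ge> 0\<close> the map \<open>q \<mapsto> D(p||q)\<close> is continuous from \<open>[0, \<infinity>)\<close> to the extended reals, even at
  \<open>q = 0\<close>, so \<open>D(P||Q)\<close> attains its minimum. By the log-sum inequality, contracting over \<open>l\<close> can
  only decrease the divergence, and for given \<open>T\<close> with contraction \<open>Q\<close> there is equality at
  \<open>S(ilj) = T(ilj) P(ij) / Q(ij)\<close>; so a minimizer \<open>Q\<close> lifts to a minimizing pair.
\<close>

section \<open>Divergence of numbers and the log-sum inequality\<close>

lemma I_div_zero_left: "I_div 0 q = ereal q"
  by (simp add: I_div_def)

text \<open>Equality holds for \<open>r = p / q\<close>, so the divergence is a supremum of functions linear in \<open>(p, q)\<close>.\<close>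

lemma I_div_ge:
  assumes "0 \<le> p" "0 \<le> q" "0 < r"
  shows "ereal (p * ln r + q - q * r) \<le> I_div p q"
proof (cases "0 < p \<and> 0 < q")
  case True
  then have "ln (q * r / p) \<le> q * r / p - 1"
    using assms by (intro ln_le_minus_one) simp
  then have "p * ln (q * r / p) \<le> p * (q * r / p - 1)"
    using True by (intro mult_left_mono) auto
  also have "\<dots> = q * r - p"
    using True by (simp add: field_simps)
  finally have "p * (ln q + ln r - ln p) \<le> q * r - p"
    using True assms by (simp add: ln_div ln_mult)
  then show ?thesis
    using True by (auto simp: I_div_def ln_div algebra_simps)
next
  case False
  then show ?thesis
    using assms by (auto simp: I_div_def not_less)
qed

lemma I_div_nonneg: "0 \<le> p \<Longrightarrow> 0 \<le> q \<Longrightarrow> 0 \<le> I_div p q"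
  using I_div_ge[of p q 1] by (simp add: zero_ereal_def)

text \<open>With the ratio \<open>r\<close> fixed, the divergence is linear in \<open>t\<close>.
  Terms with a common ratio therefore add up exactly, which is the equality case of the log-sum
  inequality.\<close>

lemma I_div_scale:
  assumes "0 \<le> t" "0 \<le> r"
  shows "I_div (t * r) t = ereal (t * (r * ln r - r + 1))"
  using assms by (auto simp: I_div_def algebra_simps)

text \<open>The log-sum inequality. If both totals are positive, the bounds of
  \<open>I_div_ge\<close> for one common \<open>r\<close> are added up, and \<open>r\<close> is
  chosen to make the bound tight for the totals.\<close>

lemma I_div_sum_le:
  assumes "finite A" "\<And>x. x \<in> A \<Longrightarrow> 0 \<le> f x" "\<And>x. x \<in> A \<Longrightarrow> 0 \<le> g x"
  shows "I_div (sum f A) (sum g A) \<le> (\<Sum>x\<in>A. I_div (f x) (g x))"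
proof -
  consider "sum f A = 0" | "0 < sum f A" "sum g A = 0" | "0 < sum f A" "0 < sum g A"
    using sum_nonneg[of A f] sum_nonneg[of A g] assms by fastforce
  then show ?thesis
  proof cases
    case 1
    then have "f x = 0" if "x \<in> A" for x
      using that assms sum_nonneg_eq_0_iff[of A f] by auto
    then show ?thesis
      using 1 by (simp add: I_div_zero_left)
  next
    case 2
    \<comment> \<open>Some term has positive mass against zero, so the right-hand side is
      infinite.\<close>
    then obtain x where x: "x \<in> A" "0 < f x"
      using assms by (metis less_eq_real_def sum_nonpos not_less)
    moreover have "g x = 0"
      using 2 x assms sum_nonneg_eq_0_iff[of A g] by auto
    ultimately have "(\<Sum>x\<in>A. I_div (f x) (g x)) = \<infinity>"
      using assms by (auto simp: sum_Pinfty I_div_def intro!: bexI[of _ x])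
    then show ?thesis by simp
  next
    case 3
    define r where "r = sum f A / sum g A"
    have "I_div (sum f A) (sum g A) = ereal (sum f A * ln r + sum g A - sum g A * r)"
      using 3 by (simp add: I_div_def r_def)
    also have "\<dots> = (\<Sum>x\<in>A. ereal (f x * ln r + g x - g x * r))"
      by (simp add: sum.distrib sum_subtractf sum_distrib_right)
    also have "\<dots> \<le> (\<Sum>x\<in>A. I_div (f x) (g x))"
      using 3 assms by (intro sum_mono I_div_ge) (auto simp: r_def)
    finally show ?thesis .
  qed
qed

section \<open>Continuity of the divergence in its second argument\<close>

lemma continuous_on_I_div:
  assumes "0 \<le> p"
  shows "continuous_on {0..} (I_div p)"
proof (cases "p = 0")
  case True
  then show ?thesis
    by (auto simp: I_div_zero_left intro!: continuous_intros)
next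
  case False
  with assms have p: "0 < p" by simp
  have "(I_div p \<longlongrightarrow> I_div p q) (at q within {0..})" if "0 \<le> q" for q
  proof (cases "q = 0")
    case True
    \<comment> \<open>The term \<open>- p * ln q\<close> blows up as \<open>q\<close> decreases to
      \<open>0\<close>, in agreement with the value \<open>\<infinity>\<close> assigned at
      \<open>0\<close>.\<close>
    have "LIM q at_right 0. p * ln (p / q) - p + q :> at_top"
      using p by real_asymp
    then have "((\<lambda>q. ereal (p * ln (p / q) - p + q)) \<longlongrightarrow> \<infinity>) (at_right 0)"
      by (simp add: tendsto_PInfty_eq_at_top)
    then have "(I_div p \<longlongrightarrow> \<infinity>) (at_right 0)"
      by (rule Lim_transform_eventually) (auto simp: I_div_def eventually_at_filter)
    then show ?thesis
      using True p by (simp add: I_div_def at_within_Ici_at_right)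
  next
    case False
    with that have q: "0 < q" by simp
    have "((\<lambda>q. ereal (p * ln (p / q) - p + q)) \<longlongrightarrow> I_div p q) (at q within {0..})"
      using p q by (auto simp: I_div_def intro!: tendsto_eq_intros)
    \<comment> \<open>The infinite branch of \<open>I_div\<close> occurs only at \<open>0\<close>,
      so near a positive \<open>q\<close> the real formula applies.\<close>
    moreover have "\<forall>\<^sub>F x in at q within {0..}. x \<in> {0<..}"
      by (rule filter_leD[OF at_le[of _ UNIV] eventually_at_in_open']) (use q in auto)
    then have "\<forall>\<^sub>F x in at q within {0..}. ereal (p * ln (p / x) - p + x) = I_div p x"
      by eventually_elim (auto simp: I_div_def)
    ultimately show ?thesis
      by (rule Lim_transform_eventually)
  qed
  then show ?thesis
    by (auto simp: continuous_on_def)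
qed

text \<open>Addition of extended reals is discontinuous where infinities of opposite sign meet;
  nonnegativity keeps away from these points.\<close>

lemma continuous_on_sum_ereal_nonneg:
  fixes f :: "'a \<Rightarrow> 'b::topological_space \<Rightarrow> ereal"
  assumes "\<And>i. i \<in> I \<Longrightarrow> continuous_on A (f i)" "\<And>i x. i \<in> I \<Longrightarrow> x \<in> A \<Longrightarrow> 0 \<le> f i x"
  shows "continuous_on A (\<lambda>x. \<Sum>i\<in>I. f i x)"
  using assms
proof (induction I rule: infinite_finite_induct)
  case (insert i I)
  then have "continuous_on A (f i)" "continuous_on A (\<lambda>x. \<Sum>i\<in>I. f i x)"
    "\<And>x. x \<in> A \<Longrightarrow> 0 \<le> f i x" "\<And>x. x \<in> A \<Longrightarrow> 0 \<le> (\<Sum>i\<in>I. f i x)"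
    by (auto intro: sum_nonneg)
  then have "continuous_on A (\<lambda>x. f i x + (\<Sum>i\<in>I. f i x))"
    unfolding continuous_on_def by (fastforce intro!: tendsto_add_ereal_nonneg)
  then show ?case
    using insert by simp
qed auto

lemma continuous_on_I_div_matrix:
  assumes "\<And>i j. 0 \<le> P $ i $ j"
  shows "continuous_on {Q. \<forall>i j. 0 \<le> Q $ i $ j} (I_div_matrix P)"
  unfolding I_div_matrix_def
  by (intro continuous_on_sum_ereal_nonneg sum_nonneg
      continuous_on_compose2[OF continuous_on_I_div] continuous_intros)
    (auto simp: assms I_div_nonneg)

section \<open>Compactness of the factor pairs, the tensors and the matrices\<close>

definition stochastic_factors :: "((real ^ 'k ^ 'm) \<times> (real ^ 'n ^ 'k)) set" where
  "stochastic_factors = {(Qm, Qp). (\<forall>i l. 0 \<le> Qm $ i $ l) \<and> (\<forall>l j. 0 \<le> Qp $ l $ j) \<and>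
     Qp *v 1 = 1 \<and> 1 \<bullet> (Qm *v 1) = 1}"

definition factor_tensor :: "(real ^ 'k ^ 'm) \<times> (real ^ 'n ^ 'k) \<Rightarrow> real ^ 'n ^ 'k ^ 'm" where
  "factor_tensor = (\<lambda>(Qm, Qp). \<chi> i l j. Qm $ i $ l * Qp $ l $ j)"

definition contract :: "real ^ 'n ^ 'k ^ 'm \<Rightarrow> real ^ 'n ^ 'm" where
  "contract T = (\<chi> i j. \<Sum>l\<in>UNIV. T $ i $ l $ j)"

text \<open>Nonnegative entries with sum 1 are at most 1, so the factor pairs are cut out of a box
  by closed linear conditions.\<close>

lemma compact_stochastic_factors:
  "compact (stochastic_factors :: ((real ^ 'k ^ 'm) \<times> (real ^ 'n ^ 'k)) set)"
proof -
  have "Qm $ i $ l \<le> 1" "Qp $ l $ j \<le> 1"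
    if "(Qm, Qp) \<in> (stochastic_factors :: ((real ^ 'k ^ 'm) \<times> (real ^ 'n ^ 'k)) set)" for Qm Qp i l j
  proof -
    have *: "\<And>i l. 0 \<le> Qm $ i $ l" "\<And>l j. 0 \<le> Qp $ l $ j"
      "\<And>l. (\<Sum>j\<in>UNIV. Qp $ l $ j) = 1" "(\<Sum>i\<in>UNIV. \<Sum>l\<in>UNIV. Qm $ i $ l) = 1"
      using that by (auto simp: stochastic_factors_def matrix_vector_mult_def inner_vec_def vec_eq_iff)
    show "Qp $ l $ j \<le> 1"
      using member_le_sum[of j UNIV "\<lambda>j. Qp $ l $ j"] * by simp
    have "Qm $ i $ l \<le> (\<Sum>l\<in>UNIV. Qm $ i $ l)"
      using * by (intro member_le_sum) auto
    also have "\<dots> \<le> (\<Sum>i\<in>UNIV. \<Sum>l\<in>UNIV. Qm $ i $ l)"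
      using * by (intro member_le_sum[of i UNIV "\<lambda>i. \<Sum>l\<in>UNIV. Qm $ i $ l"] sum_nonneg) auto
    finally show "Qm $ i $ l \<le> 1" using * by simp
  qed
  \<comment> \<open>The intervals refer to the componentwise order, with \<open>1\<close> the
    all-ones matrix.\<close>
  then have "stochastic_factors = ({0..1} \<times> {0..1}) \<inter>
      {X :: (real ^ 'k ^ 'm) \<times> (real ^ 'n ^ 'k). snd X *v 1 = 1 \<and> 1 \<bullet> (fst X *v 1) = 1}"
    by (auto simp: stochastic_factors_def less_eq_vec_def)
  moreover have "closed {X :: (real ^ 'k ^ 'm) \<times> (real ^ 'n ^ 'k). snd X *v 1 = 1 \<and> 1 \<bullet> (fst X *v 1) = 1}"
    unfolding matrix_vector_mult_def
    by (intro closed_Collect_conj closed_Collect_eq continuous_intros)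
  ultimately show ?thesis
    by (elim ssubst) (intro compact_Int_closed compact_Times compact_interval)
qed

lemma tensor_Q_eq: "tensor_Q = factor_tensor ` stochastic_factors"
proof (intro set_eqI iffI)
  fix T assume "T \<in> tensor_Q"
  then obtain Qm Qp where "(Qm, Qp) \<in> stochastic_factors"
    "\<And>i l j. T $ i $ l $ j = Qm $ i $ l * Qp $ l $ j"
    unfolding tensor_Q_def stochastic_factors_def by blast
  then show "T \<in> factor_tensor ` stochastic_factors"
    by (intro image_eqI[of _ _ "(Qm, Qp)"]) (simp_all add: factor_tensor_def vec_eq_iff)
next
  fix T assume "T \<in> factor_tensor ` stochastic_factors"
  then obtain Qm Qp where "(Qm, Qp) \<in> stochastic_factors" "T = factor_tensor (Qm, Qp)"
    by auto
  then show "T \<in> tensor_Q"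
    unfolding tensor_Q_def stochastic_factors_def factor_tensor_def by auto
qed

lemma compact_tensor_Q: "compact (tensor_Q :: (real ^ 'n ^ 'k ^ 'm) set)"
  unfolding tensor_Q_eq factor_tensor_def case_prod_beta
  by (intro compact_continuous_image compact_stochastic_factors continuous_intros)

lemma matrix_Q_eq: "matrix_Q TYPE('k::finite) = contract ` (tensor_Q :: (real ^ 'n ^ 'k ^ 'm) set)"
proof (intro set_eqI iffI)
  fix Q :: "real ^ 'n ^ 'm" assume "Q \<in> matrix_Q TYPE('k)"
  then obtain T :: "real ^ 'n ^ 'k ^ 'm"
    where "T \<in> tensor_Q" "\<And>i j. Q $ i $ j = (\<Sum>l\<in>UNIV. T $ i $ l $ j)"
    unfolding matrix_Q_def by blast
  then show "Q \<in> contract ` (tensor_Q :: (real ^ 'n ^ 'k ^ 'm) set)"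
    by (intro image_eqI[of _ _ T]) (simp_all add: contract_def vec_eq_iff)
next
  fix Q :: "real ^ 'n ^ 'm" assume "Q \<in> contract ` (tensor_Q :: (real ^ 'n ^ 'k ^ 'm) set)"
  then obtain T :: "real ^ 'n ^ 'k ^ 'm" where T: "T \<in> tensor_Q" "Q = contract T"
    by auto
  moreover from T(1) have "0 \<le> T $ i $ l $ j" for i l j
    by (simp add: tensor_Q_def)
  ultimately show "Q \<in> matrix_Q TYPE('k)"
    unfolding matrix_Q_def by (auto simp: contract_def sum_nonneg)
qed

lemma compact_matrix_Q: "compact (matrix_Q TYPE('k::finite) :: (real ^ 'n ^ 'm) set)"
  unfolding matrix_Q_eq contract_def
  by (intro compact_continuous_image compact_tensor_Q continuous_intros)

lemma tensor_Q_nonempty: "(tensor_Q :: (real ^ 'n ^ 'k ^ 'm) set) \<noteq> {}"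
proof -
  \<comment> \<open>Uniform weights: \<open>Qm\<close> spreads mass 1 over all its entries,
    \<open>Qp\<close> over each row.\<close>
  have "(\<chi> i l. 1 / (CARD('m) * CARD('k)), \<chi> l j. 1 / CARD('n))
      \<in> (stochastic_factors :: ((real ^ 'k ^ 'm) \<times> (real ^ 'n ^ 'k)) set)"
    by (auto simp: stochastic_factors_def matrix_vector_mult_def inner_vec_def vec_eq_iff)
  then show ?thesis
    unfolding tensor_Q_eq by blast
qed

section \<open>Divergence of tensors against that of their contractions\<close>

lemma I_div_tensor_swap:
  "I_div_tensor S T = (\<Sum>i\<in>UNIV. \<Sum>j\<in>UNIV. \<Sum>l\<in>UNIV. I_div (S $ i $ l $ j) (T $ i $ l $ j))"
  unfolding I_div_tensor_def by (intro sum.cong refl sum.swap)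

text \<open>With \<open>l\<close> as the innermost index, this is the log-sum inequality for each
  pair \<open>i\<close>, \<open>j\<close>.\<close>

lemma I_div_matrix_contract_le:
  assumes "S \<in> tensor_P P" "T \<in> tensor_Q"
  shows "I_div_matrix P (contract T) \<le> I_div_tensor S T"
proof -
  have "P $ i $ j = (\<Sum>l\<in>UNIV. S $ i $ l $ j)" for i j
    using assms by (simp add: tensor_P_def)
  then show ?thesis
    using assms unfolding I_div_matrix_def I_div_tensor_swap contract_def
    by (auto simp: tensor_P_def tensor_Q_def intro!: sum_mono I_div_sum_le)
qed

lemma I_div_tensor_attains_contract:
  fixes T :: "real ^ 'n ^ 'k ^ 'm"
  assumes P: "\<And>i j. 0 \<le> P $ i $ j" and T: "T \<in> tensor_Q"
  shows "\<exists>S \<in> tensor_P P. I_div_tensor S T = I_div_matrix P (contract T)"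
proof -
  have T0: "0 \<le> T $ i $ l $ j" for i l j
    using T by (simp add: tensor_Q_def)
  have Q0: "0 \<le> contract T $ i $ j" for i j
    using T0 by (simp add: contract_def sum_nonneg)
  \<comment> \<open>The constraint and the divergence decouple over the pairs \<open>i\<close>,
    \<open>j\<close>, so each fibre over \<open>l\<close> can be treated on its own and the choices
    assembled afterwards.\<close>
  define optimal where "optimal i j s \<longleftrightarrow> (\<forall>l. 0 \<le> s l) \<and> (\<Sum>l\<in>UNIV. s l) = P $ i $ j \<and>
      (\<Sum>l\<in>UNIV. I_div (s l) (T $ i $ l $ j)) = I_div (P $ i $ j) (contract T $ i $ j)" for i j s
  have "\<exists>s. optimal i j s" for i j
  proof (cases "contract T $ i $ j = 0")
    case True
    then have T_eq: "T $ i $ l $ j = 0" for l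
      using T0 sum_nonneg_eq_0_iff[of UNIV "\<lambda>l. T $ i $ l $ j"] by (simp add: contract_def)
    \<comment> \<open>Both sides are infinite unless \<open>P $ i $ j = 0\<close>, so any distribution over \<open>l\<close> will do.\<close>
    have "(\<Sum>l::'k\<in>UNIV. I_div (P $ i $ j / CARD('k)) 0) = I_div (P $ i $ j) 0"
      using P[of i j] by (cases "P $ i $ j = 0") (auto simp: I_div_def less_le sum_Pinfty)
    then show ?thesis
      using P by (intro exI[of _ "\<lambda>_. P $ i $ j / CARD('k)"]) (simp add: optimal_def True T_eq)
  next
    case False
    \<comment> \<open>Scaling the whole fibre of \<open>T\<close> by this factor, independent of
      \<open>l\<close>, gives it total mass \<open>P $ i $ j\<close> and equality in the log-sum
      inequality.\<close>
    define r where "r = P $ i $ j / contract T $ i $ j"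
    have r0: "0 \<le> r"
      using P Q0 by (simp add: r_def)
    have P_eq: "P $ i $ j = contract T $ i $ j * r"
      using False by (simp add: r_def)
    show ?thesis
      unfolding optimal_def
    proof (intro exI[of _ "\<lambda>l. T $ i $ l $ j * r"] conjI allI)
      show "(\<Sum>l\<in>UNIV. I_div (T $ i $ l $ j * r) (T $ i $ l $ j))
          = I_div (P $ i $ j) (contract T $ i $ j)"
        unfolding P_eq using T0 Q0 r0
        by (simp add: I_div_scale) (simp add: contract_def sum_distrib_right)
    qed (use T0 r0 in \<open>auto simp: P_eq contract_def sum_distrib_right\<close>)
  qed
  then obtain s where "\<And>i j. optimal i j (s i j)"
    by metis
  then show ?thesis
    by (intro bexI[of _ "\<chi> i l j. s i j l"])
      (simp_all add: optimal_def I_div_tensor_swap I_div_matrix_def tensor_P_def)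
qed

section \<open>Existence of minimizers and equality of the minima\<close>

theorem proposition3p2:
  fixes P :: "real ^ 'n ^ 'm"
  assumes "prob_matrix P"
    and "CARD('k::finite) \<le> min CARD('m) CARD('n)"
  shows "(\<exists>ST. is_arg_min (\<lambda>(S, T). I_div_tensor S T)
                 (\<lambda>ST. ST \<in> tensor_P P \<times> (tensor_Q :: (real ^ 'n ^ 'k ^ 'm) set)) ST) \<and>
         (\<exists>Q. is_arg_min (\<lambda>Q. I_div_matrix P Q) (\<lambda>Q. Q \<in> matrix_Q TYPE('k)) Q) \<and>
         (INF Q\<in>matrix_Q TYPE('k). I_div_matrix P Q) =
         (INF (S, T)\<in>tensor_P P \<times> (tensor_Q :: (real ^ 'n ^ 'k ^ 'm) set). I_div_tensor S T)"
proof -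
  let ?Q = "matrix_Q TYPE('k) :: (real ^ 'n ^ 'm) set"
  let ?T = "tensor_Q :: (real ^ 'n ^ 'k ^ 'm) set"
  have P: "0 \<le> P $ i $ j" for i j
    using assms(1) by (simp add: prob_matrix_def)
  have "continuous_on ?Q (I_div_matrix P)"
    by (rule continuous_on_subset[OF continuous_on_I_div_matrix])
      (auto simp: P matrix_Q_def)
  then obtain Q where Q: "Q \<in> ?Q" "\<And>Q'. Q' \<in> ?Q \<Longrightarrow> I_div_matrix P Q \<le> I_div_matrix P Q'"
    using continuous_attains_inf[of ?Q] compact_matrix_Q tensor_Q_nonempty
    unfolding matrix_Q_eq by blast
  then obtain T where T: "T \<in> ?T" "Q = contract T"
    by (auto simp: matrix_Q_eq)
  then obtain S where S: "S \<in> tensor_P P" "I_div_tensor S T = I_div_matrix P Q"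
    using I_div_tensor_attains_contract P by blast
  \<comment> \<open>The contraction of \<open>T'\<close> competes with \<open>Q\<close> in the
    matrix problem, and its divergence bounds that of the pair from below.\<close>
  have min: "I_div_tensor S T \<le> I_div_tensor S' T'" if "S' \<in> tensor_P P" "T' \<in> ?T" for S' T'
    using I_div_matrix_contract_le[OF that] Q(2)[of "contract T'"] that S(2)
    by (auto simp: matrix_Q_eq)
  have "(INF Q\<in>?Q. I_div_matrix P Q) = I_div_matrix P Q"
    using Q by (intro antisym INF_lower INF_greatest)
  moreover have "(INF (S, T)\<in>tensor_P P \<times> ?T. I_div_tensor S T) = I_div_tensor S T"
    using S(1) T(1) min by (intro antisym INF_lower2[of "(S, T)"] INF_greatest) auto
  moreover have "is_arg_min (\<lambda>(S, T). I_div_tensor S T) (\<lambda>ST. ST \<in> tensor_P P \<times> ?T) (S, T)"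
    using S(1) T(1) min by (auto simp: is_arg_min_def not_less)
  moreover have "is_arg_min (\<lambda>Q. I_div_matrix P Q) (\<lambda>Q. Q \<in> ?Q) Q"
    using Q by (auto simp: is_arg_min_def not_less)
  ultimately show ?thesis
    using S(2) by metis
qed

end
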